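(* For every real $\rho>0$, $$\mathsf L_\rho(N)\leqslant N^{1/2+o(1)}+N^{1-2/\rho+o(1)},\qquad N\to\infty.$$
   Context: Let $\mathbf e(z)=\exp(2\pi i z)$, $\mathsf T=[0,1]$, and for real $x,y$ and a positive integer $N$ let $G(x,y;N)=\sum_{n=1}^N\mathbf e(xn+yn^2)$. Define $$\mathsf L_\rho(N)=\Big(\int_{\mathsf T}\sup_{x\in\mathsf T}|G(x,y;N)|^\rho\,dy\Big)^{1/\rho}.$$ The notation $F(N)\leqslant N^{a+o(1)}+N^{b+o(1)}$ means: for every $\varepsilon>0$, $F(N)\leqslant N^{a+\varepsilon}+N^{b+\varepsilon}$ for all sufficiently large $N$ (depending on $\varepsilon$ and $\rho$). *)

theory Defs
  imports "HOL-Analysis.Analysis"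
begin

definition expi2 :: "complex \<Rightarrow> complex" where
  "expi2 z = exp (2 * of_real pi * \<i> * z)"

definition unit_T :: "real set" where
  "unit_T = {0..1}"

definition gauss_sum :: "real \<Rightarrow> real \<Rightarrow> nat \<Rightarrow> complex" where
  "gauss_sum x y N = (\<Sum>n=1..N. expi2 (of_real (x * real n + y * (real n)\<^sup>2)))"

text \<open>
  The integrand is a supremum, over a compact set, of a jointly continuous function; so the
  supremum is finite and the integrand is continuous in \<open>y\<close>, and neither the real-valued
  supremum nor the Lebesgue integral takes a default value here.
\<close>

definition L_rho :: "real \<Rightarrow> nat \<Rightarrow> real" where
  "L_rho \<rho> N =
     (LINT y:unit_T|lborel. (SUP x\<in>unit_T. cmod (gauss_sum x y N) powr \<rho>)) powr (1 / \<rho>)"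

end

theory Submission
  imports Defs "HOL-Real_Asymp.Real_Asymp"
begin

text \<open>
  Everything follows from the case \<open>\<rho> = 4\<close>: for \<open>\<rho> > 4\<close> use the trivial bound \<open>|G| \<le> N\<close> for the
  excess power, and for \<open>\<rho> < 4\<close> the integrals over the unit interval are monotone in \<open>\<rho>\<close> up to
  constants. Weyl differencing bounds \<open>|G|\<^sup>2\<close>, uniformly in \<open>x\<close>, by a sum over \<open>h \<le> N\<close> of
  geometric sums at the frequency \<open>2hy\<close>. A geometric sum is in turn dominated pointwise by
  an average of Fejer kernels, which is a trigonometric polynomial of degree less than \<open>N\<close> with
  nonnegative coefficients at most the harmonic number \<open>H\<^sub>N\<close>. The second moment of the resulting
  majorant therefore counts the solutions of \<open>hk + h'k' = 0\<close> with all variables of size at most \<open>N\<close>,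
  of which there are \<open>O(N\<^sup>2 log N)\<close>.
\<close>

section \<open>Weyl differencing and the Fejer majorant\<close>

text \<open>Near z = 1 no cancellation occurs: z^n is within n |z - 1| of 1, so the sum is within M
  (M - 1) |z - 1| / 2 \<le> M / 2 of M.\<close>

lemma norm_geometric_sum_ge:
  fixes z :: complex
  assumes "norm z = 1" "real M * norm (z - 1) \<le> 1"
  shows "real M / 2 \<le> norm (\<Sum>n<M. z ^ n)"
proof -
  have "norm ((\<Sum>n<M. z ^ n) - of_nat M) = norm (\<Sum>n<M. z ^ n - 1)"
    by (simp add: sum_subtractf)
  also have "\<dots> \<le> (\<Sum>n<M. real n * norm (z - 1))"
    using norm_power_diff[of z 1] assms(1) by (intro sum_norm_le) auto
  also have "\<dots> = (\<Sum>n<M. real n) * norm (z - 1)"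
    by (simp add: sum_distrib_right)
  also have "(\<Sum>n<M. real n) = real M * (real M - 1) / 2"
    by (induction M) (auto simp: field_simps)
  also have "real M * (real M - 1) / 2 * norm (z - 1) \<le> real M / 2"
  proof (cases "M = 0")
    case False
    have "(real M - 1) * norm (z - 1) \<le> 1"
      using assms(2) by (simp add: algebra_simps) (smt (verit) norm_ge_zero)
    then have "(real M / 2) * ((real M - 1) * norm (z - 1)) \<le> (real M / 2) * 1"
      by (intro mult_left_mono) auto
    then show ?thesis by (simp add: mult_ac)
  qed simp
  finally have "norm (of_nat M - (\<Sum>n<M. z ^ n)) \<le> real M / 2"
    by (simp add: norm_minus_commute)
  moreover have "norm (of_nat M :: complex) - norm (\<Sum>n<M. z ^ n) \<le> norm (of_nat M - (\<Sum>n<M. z ^ n))"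
    by (rule norm_triangle_ineq2)
  ultimately show ?thesis by simp
qed

text \<open>With \<delta> = |z - 1|, the left side is at most min(L, 2/\<delta>), and the right side
  is of size at least min(N, 1/\<delta>). The gain is that the right side is free of L and, for z on
  the unit circle, a trigonometric polynomial, which the absolute value on the left is not.\<close>

lemma norm_geometric_sum_le_fejer_average:
  fixes z :: complex
  assumes z: "norm z = 1" and "L \<le> N" "1 \<le> N"
  shows "norm (\<Sum>n<L. z ^ n) \<le> 16 * (\<Sum>M=1..N. (norm (\<Sum>n<M. z ^ n))\<^sup>2 / (real M)\<^sup>2)"
    (is "?D \<le> 16 * ?T")
proof -
  define \<delta> where "\<delta> = norm (z - 1)"
  txt \<open>Every kernel of length \<open>M \<le> min N (1/\<delta>)\<close> is near its peak and contributes at least \<open>1/4\<close>.\<close>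
  have lower: "real K / 4 \<le> ?T" if "K \<le> N" "real K * \<delta> \<le> 1" for K
  proof -
    have "real K / 4 = (\<Sum>M=1..K. 1 / 4)" by simp
    also have "\<dots> \<le> (\<Sum>M=1..K. (norm (\<Sum>n<M. z ^ n))\<^sup>2 / (real M)\<^sup>2)"
    proof (intro sum_mono)
      fix M assume M: "M \<in> {1..K}"
      have "real M * \<delta> \<le> real K * \<delta>"
        using M by (intro mult_right_mono) (auto simp: \<delta>_def)
      then have "real M / 2 \<le> norm (\<Sum>n<M. z ^ n)"
        using that by (intro norm_geometric_sum_ge z) (auto simp: \<delta>_def)
      then have "(real M / 2)\<^sup>2 \<le> (norm (\<Sum>n<M. z ^ n))\<^sup>2"
        by (intro power_mono) auto
      then show "1 / 4 \<le> (norm (\<Sum>n<M. z ^ n))\<^sup>2 / (real M)\<^sup>2"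
        using M by (simp add: field_simps power2_eq_square)
    qed
    also have "\<dots> \<le> ?T" using that by (intro sum_mono2) auto
    finally show ?thesis .
  qed
  have one: "1 \<le> ?T"
  proof -
    have "(\<Sum>M\<in>{1::nat}. (norm (\<Sum>n<M. z ^ n))\<^sup>2 / (real M)\<^sup>2) \<le> ?T"
      using assms by (intro sum_mono2) auto
    then show ?thesis by simp
  qed
  have trivial: "?D \<le> real L"
    using sum_norm_le[of "{..<L}" "\<lambda>n. z ^ n" "\<lambda>_. 1"] z by (simp add: norm_power)
  have decay: "?D * \<delta> \<le> 2"
  proof -
    have "?D * \<delta> = norm (z ^ L - 1)"
      unfolding \<delta>_def norm_mult[symmetric] power_diff_1_eq by (simp add: mult.commute)
    also have "\<dots> \<le> norm (z ^ L) + norm (1 :: complex)" by (rule norm_triangle_ineq4)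
    finally show ?thesis using z by (simp add: norm_power)
  qed
  \<comment> \<open>The first case gives \<open>?D\<close> \<le> N \<le> 4 \<open>?T\<close>, the
    second \<open>?D\<close> \<le> 2 \<le> 2 \<open>?T\<close>. In the third, K = floor(1/\<delta>)
    \<ge> 1 and \<open>?D\<close> \<le> 2/\<delta> < 2 (K + 1) \<le> 4 K \<le> 16 \<open>?T\<close>,
    which fixes the constant 16.\<close>
  consider "real N * \<delta> \<le> 1" | "real N * \<delta> > 1" "\<delta> \<ge> 1" | "real N * \<delta> > 1" "\<delta> < 1"
    by linarith
  then show ?thesis
  proof cases
    case 1
    then show ?thesis using lower[of N] trivial assms(2) by simp
  next
    case 2
    then have "?D * 1 \<le> ?D * \<delta>" by (intro mult_left_mono) auto
    then show ?thesis using decay one by simp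
  next
    case 3
    then have pos: "\<delta> > 0" by (smt (verit) mult_nonneg_nonpos of_nat_0_le_iff)
    define K where "K = nat \<lfloor>1 / \<delta>\<rfloor>"
    have f1: "1 \<le> \<lfloor>1 / \<delta>\<rfloor>" using 3 pos by (simp add: field_simps)
    have K: "real K = of_int \<lfloor>1 / \<delta>\<rfloor>"
      unfolding K_def by (rule of_nat_nat) (use f1 in linarith)
    have K1: "1 \<le> real K" using f1 K by simp
    have Ku: "real K \<le> 1 / \<delta>" "1 / \<delta> < real K + 1" unfolding K by linarith+
    have "1 / \<delta> < real N" using 3 pos by (simp add: field_simps)
    then have "K \<le> N" using Ku by linarith
    moreover have "real K * \<delta> \<le> 1" using Ku pos by (simp add: field_simps)
    ultimately have "real K / 4 \<le> ?T" by (rule lower)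
    moreover have "?D \<le> 2 / \<delta>" using decay pos by (simp add: field_simps)
    ultimately show ?thesis using Ku K1 by simp
  qed
qed

text \<open>Expand the square, pair each (n, m) with its conjugate (m, n), and group the pairs m < n
  by h = n - m. The term h = N is an empty sum.\<close>

lemma norm_sum_squared_le_correlations:
  fixes f :: "nat \<Rightarrow> complex"
  shows "(norm (\<Sum>n<N. f n))\<^sup>2
    \<le> (\<Sum>n<N. (norm (f n))\<^sup>2) + 2 * (\<Sum>h=1..N. norm (\<Sum>m<N-h. f (m + h) * cnj (f m)))"
proof -
  have "(norm (\<Sum>n<N. f n))\<^sup>2
    = (\<Sum>n<N. (norm (f n))\<^sup>2) + 2 * Re (\<Sum>n<N. \<Sum>m<n. f n * cnj (f m))"
  proof (induction N)
    case (Suc N)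
    have "(norm (a + b))\<^sup>2 = (norm a)\<^sup>2 + (norm b)\<^sup>2 + 2 * Re (b * cnj a)" for a b :: complex
      unfolding cmod_power2 by (simp add: power2_eq_square algebra_simps)
    then show ?case using Suc by (simp add: sum_distrib_left cnj_sum sum.distrib algebra_simps)
  qed simp
  also have "(\<Sum>n<N. \<Sum>m<n. f n * cnj (f m)) = (\<Sum>h=1..N. \<Sum>m<N-h. f (m + h) * cnj (f m))"
    unfolding sum.Sigma[OF finite_lessThan ballI[OF finite_lessThan]]
      sum.Sigma[OF finite_atLeastAtMost ballI[OF finite_lessThan]]
    by (rule sum.reindex_bij_witness[of _ "\<lambda>(h, m). (m + h, m)" "\<lambda>(n, m). (n - m, m)"]) auto
  also have "Re \<dots> \<le> (\<Sum>h=1..N. norm (\<Sum>m<N-h. f (m + h) * cnj (f m)))"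
    by (rule order_trans[OF complex_Re_le_cmod sum_norm_le]) simp
  finally show ?thesis by simp
qed

text \<open>The Fejer kernel of order M is the squared norm divided by M; the further division by M
  normalizes its peak value to 1.\<close>

definition fejer_average :: "nat \<Rightarrow> real \<Rightarrow> real" where
  "fejer_average N t = (\<Sum>M=1..N. (norm (\<Sum>n<M. cis (2 * pi * t) ^ n))\<^sup>2 / (real M)\<^sup>2)"

text \<open>Differencing moves x into a unimodular factor that does not depend on the summation
  variable, whence the uniformity in x. The diagonal contributes N, absorbed because every average
  is at least 1; so 33 = 1 + 2 * 16.\<close>

lemma gauss_sum_squared_le:
  assumes "1 \<le> N"
  shows "(norm (gauss_sum x y N))\<^sup>2 \<le> 33 * (\<Sum>h=1..N. fejer_average N (2 * real h * y))"
proof -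
  define f where "f n = cis (2 * pi * (x * real (Suc n) + y * (real (Suc n))\<^sup>2))" for n
  have "gauss_sum x y N = (\<Sum>n=1..N. cis (2 * pi * (x * real n + y * (real n)\<^sup>2)))"
    unfolding gauss_sum_def expi2_def cis_conv_exp by (intro sum.cong) (auto simp: mult_ac)
  also have "\<dots> = (\<Sum>n<N. f n)"
    unfolding f_def by (rule sum.reindex_bij_witness[of _ Suc "\<lambda>n. n - 1"]) auto
  finally have G: "gauss_sum x y N = (\<Sum>n<N. f n)" .
  have corr: "norm (\<Sum>m<N-h. f (m + h) * cnj (f m)) \<le> 16 * fejer_average N (2 * real h * y)" for h
  proof -
    define z where "z = cis (2 * pi * (2 * real h * y))"
    \<comment> \<open>Since \<open>f\<close> is shifted by one, the quadratic phase is (m + h + 1)^2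
      - (m + 1)^2 = h^2 + 2h + 2hm, where only the last term involves m.\<close>
    have "f (m + h) * cnj (f m) = cis (2 * pi * (x * h + y * (h\<^sup>2 + 2 * h))) * z ^ m" for m
      unfolding f_def z_def cis_cnj Complex.DeMoivre cis_mult
      by (rule arg_cong[where f = cis]) (simp add: power2_eq_square algebra_simps)
    then have "(\<Sum>m<N-h. f (m + h) * cnj (f m))
        = cis (2 * pi * (x * h + y * (h\<^sup>2 + 2 * h))) * (\<Sum>m<N-h. z ^ m)"
      by (simp add: sum_distrib_left)
    then have "norm (\<Sum>m<N-h. f (m + h) * cnj (f m)) = norm (\<Sum>m<N-h. z ^ m)"
      by (simp add: norm_mult)
    also have "\<dots> \<le> 16 * fejer_average N (2 * real h * y)"
      unfolding fejer_average_def z_def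
      by (rule norm_geometric_sum_le_fejer_average) (use assms in auto)
    finally show ?thesis .
  qed
  have ge1: "1 \<le> fejer_average N t" for t
  proof -
    have "(\<Sum>M\<in>{1::nat}. (norm (\<Sum>n<M. cis (2 * pi * t) ^ n))\<^sup>2 / (real M)\<^sup>2) \<le> fejer_average N t"
      unfolding fejer_average_def using assms by (intro sum_mono2) auto
    then show ?thesis by simp
  qed
  have "(norm (gauss_sum x y N))\<^sup>2 \<le> real N + 2 * (\<Sum>h=1..N. norm (\<Sum>m<N-h. f (m + h) * cnj (f m)))"
    using norm_sum_squared_le_correlations[of f N] unfolding G by (simp add: f_def)
  also have "\<dots> \<le> (\<Sum>h=1..N. fejer_average N (2 * real h * y))
      + 2 * (\<Sum>h=1..N. 16 * fejer_average N (2 * real h * y))"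
  proof (intro add_mono mult_left_mono sum_mono corr)
    show "real N \<le> (\<Sum>h=1..N. fejer_average N (2 * real h * y))"
      using sum_mono[of "{1..N}" "\<lambda>_. 1" "\<lambda>h. fejer_average N (2 * real h * y)"] ge1 by simp
  qed simp
  finally show ?thesis by (simp add: sum_distrib_left[symmetric])
qed

section \<open>Second moment of the majorant\<close>

text \<open>The k-th Fourier coefficient of \<open>fejer_average N\<close>. The cardinality is
  max(0, M - |k|), left as a count of representations because that is how it arises from expanding
  the square.\<close>

definition fejer_coeff :: "nat \<Rightarrow> int \<Rightarrow> real" where
  "fejer_coeff N k = (\<Sum>M=1..N.
     real (card {(a, b). a < M \<and> b < M \<and> int a - int b = k}) / (real M)\<^sup>2)"

lemma fejer_coeff_nonneg: "0 \<le> fejer_coeff N k"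
  unfolding fejer_coeff_def by (intro sum_nonneg) auto

text \<open>For fixed k a pair (a, b) is determined by a, so each count is at most M and each
  summand at most 1/M.\<close>

lemma fejer_coeff_le_harm: "fejer_coeff N k \<le> harm N"
  unfolding fejer_coeff_def harm_def
proof (intro sum_mono)
  fix M assume M: "M \<in> {1..N}"
  have "card {(a, b). a < M \<and> b < M \<and> int a - int b = k} \<le> card {..<M}"
    by (rule card_inj_on_le[where f = fst]) (auto simp: inj_on_def)
  then show "real (card {(a, b). a < M \<and> b < M \<and> int a - int b = k}) / (real M)\<^sup>2
      \<le> inverse (real M)"
    using M by (simp add: field_simps power2_eq_square)
qed

text \<open>Group the pairs (a, b) of the expanded square by their difference. The range of k
  depends on N instead of M, so that the sums over k and M can later be interchanged.\<close>

lemma norm_geometric_sum_cis_squared: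
  assumes "M \<le> N"
  shows "of_real ((norm (\<Sum>n<M. cis \<theta> ^ n))\<^sup>2)
    = (\<Sum>k=-int N..int N. of_nat (card {(a, b). a < M \<and> b < M \<and> int a - int b = k})
        * cis (of_int k * \<theta>))"
proof -
  let ?S = "{..<M} \<times> {..<M}"
  let ?g = "\<lambda>(a, b). int a - int b"
  have "of_real ((norm (\<Sum>n<M. cis \<theta> ^ n))\<^sup>2) = (\<Sum>a<M. cis \<theta> ^ a) * cnj (\<Sum>b<M. cis \<theta> ^ b)"
    by (metis complex_norm_square)
  also have "\<dots> = (\<Sum>(a, b)\<in>?S. cis \<theta> ^ a * cnj (cis \<theta> ^ b))"
    by (simp add: cnj_sum sum_product sum.cartesian_product)
  also have "\<dots> = (\<Sum>p\<in>?S. cis (of_int (?g p) * \<theta>))"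
    by (intro sum.cong) (auto simp: Complex.DeMoivre cis_cnj cis_mult algebra_simps)
  also have "\<dots> = (\<Sum>k=-int N..int N. \<Sum>p\<in>{p \<in> ?S. ?g p = k}. cis (of_int (?g p) * \<theta>))"
    using assms by (intro sum.group[symmetric]) auto
  finally have "of_real ((norm (\<Sum>n<M. cis \<theta> ^ n))\<^sup>2)
      = (\<Sum>k=-int N..int N. \<Sum>p\<in>{p \<in> ?S. ?g p = k}. cis (of_int (?g p) * \<theta>))" .
  moreover have "\<dots> = (\<Sum>k=-int N..int N. of_nat (card {p \<in> ?S. ?g p = k}) * cis (of_int k * \<theta>))"
    by (intro sum.cong) auto
  moreover have "{p \<in> ?S. ?g p = k} = {(a, b). a < M \<and> b < M \<and> int a - int b = k}" for k
    by auto
  ultimately show ?thesis by simp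
qed

lemma fejer_average_expansion:
  "of_real (fejer_average N t)
    = (\<Sum>k=-int N..int N. of_real (fejer_coeff N k) * cis (2 * pi * (of_int k * t)))"
proof -
  have "of_real (fejer_average N t) = (\<Sum>M=1..N.
      (\<Sum>k=-int N..int N. of_nat (card {(a, b). a < M \<and> b < M \<and> int a - int b = k})
        * cis (of_int k * (2 * pi * t))) / of_nat M ^ 2)"
    unfolding fejer_average_def of_real_sum
    by (intro sum.cong) (auto simp: norm_geometric_sum_cis_squared[where N = N]
      simp del: of_real_power simp flip: of_nat_power)
  also have "\<dots> = (\<Sum>k=-int N..int N. \<Sum>M=1..N.
      of_nat (card {(a, b). a < M \<and> b < M \<and> int a - int b = k})
        * cis (of_int k * (2 * pi * t)) / of_nat M ^ 2)"
    unfolding sum_divide_distrib by (rule sum.swap)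
  also have "\<dots> = (\<Sum>k=-int N..int N. of_real (fejer_coeff N k) * cis (2 * pi * (of_int k * t)))"
    by (intro sum.cong refl)
      (simp add: fejer_coeff_def sum_distrib_left of_real_sum mult_ac)
  finally show ?thesis .
qed

section \<open>Orthogonality of characters on the unit interval\<close>

lemma has_integral_cis:
  "((\<lambda>y. cis (2 * pi * (of_int m * y))) has_integral (if m = 0 then 1 else 0)) {0..1}"
proof (cases "m = 0")
  case True
  then show ?thesis using has_integral_const_real[of "1 :: complex" 0 1] by simp
next
  case False
  let ?F = "\<lambda>y. cis (2 * pi * (of_int m * y)) / (2 * pi * of_int m * \<i>)"
  have "((\<lambda>y. cis (2 * pi * (of_int m * y))) has_integral ?F 1 - ?F 0) {0..1}"
  proof (rule fundamental_theorem_of_calculus)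
    fix y :: real
    have "((\<lambda>w. exp (\<i> * (2 * pi * of_int m * w)) / (2 * pi * of_int m * \<i>)) has_field_derivative
        exp (\<i> * (2 * pi * of_int m * of_real y))) (at (of_real y))"
      using False by (auto intro!: derivative_eq_intros simp: field_simps)
    from has_vector_derivative_real_field[OF this]
    show "(?F has_vector_derivative cis (2 * pi * (of_int m * y))) (at y within {0..1})"
      by (simp add: cis_conv_exp mult_ac)
  qed simp
  moreover have "cis (2 * pi * of_int m) = 1"
    by (simp add: cis_multiple_2pi)
  ultimately show ?thesis using False by simp
qed

text \<open>Orthogonality leaves only the pairs of opposite frequencies; the sign is plus because F
  is real and no conjugate is taken. Since f may repeat values, a frequency 2hk can be indexed by
  (h, k) without collecting equal products.\<close>

lemma has_integral_trig_poly_squared: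
  fixes F :: "real \<Rightarrow> real" and c :: "'a \<Rightarrow> real" and f :: "'a \<Rightarrow> int"
  assumes "finite P"
    and F: "\<And>y. of_real (F y) = (\<Sum>p\<in>P. of_real (c p) * cis (2 * pi * (of_int (f p) * y)))"
  shows "((\<lambda>y. (F y)\<^sup>2) has_integral
    (\<Sum>(p, q)\<in>{(p, q). p \<in> P \<and> q \<in> P \<and> f p + f q = 0}. c p * c q)) {0..1}"
proof -
  let ?I = "\<Sum>(p, q)\<in>P \<times> P. of_real (c p * c q) * (if f p + f q = 0 then 1 else 0 :: complex)"
  have "complex_of_real ((F y)\<^sup>2)
      = (\<Sum>(p, q)\<in>P \<times> P. of_real (c p * c q) * cis (2 * pi * (of_int (f p + f q) * y)))" for y
  proof -
    have "complex_of_real ((F y)\<^sup>2) = of_real (F y) * of_real (F y)"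
      by (simp add: power2_eq_square)
    also have "\<dots> = (\<Sum>(p, q)\<in>P \<times> P. (of_real (c p) * cis (2 * pi * (of_int (f p) * y)))
         * (of_real (c q) * cis (2 * pi * (of_int (f q) * y))))"
      unfolding F sum_product sum.cartesian_product ..
    also have "\<dots> = (\<Sum>(p, q)\<in>P \<times> P. of_real (c p * c q) * cis (2 * pi * (of_int (f p + f q) * y)))"
      by (intro sum.cong refl) (auto simp: mult_ac algebra_simps simp flip: cis_mult)
    finally show ?thesis .
  qed
  moreover have "((\<lambda>y. \<Sum>(p, q)\<in>P \<times> P. of_real (c p * c q) * cis (2 * pi * (of_int (f p + f q) * y)))
      has_integral ?I) {0..1}"
    unfolding case_prod_beta using assms(1)
    by (intro has_integral_sum has_integral_mult_right has_integral_cis finite_cartesian_product)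
  ultimately have "((\<lambda>y. complex_of_real ((F y)\<^sup>2)) has_integral ?I) {0..1}"
    by simp
  from has_integral_Re[OF this] have "((\<lambda>y. (F y)\<^sup>2) has_integral Re ?I) {0..1}"
    by simp
  moreover have "Re ?I = (\<Sum>(p, q)\<in>P \<times> P. if f p + f q = 0 then c p * c q else 0)"
    unfolding Re_sum by (intro sum.cong) auto
  moreover have "(\<Sum>(p, q)\<in>P \<times> P. if f p + f q = 0 then c p * c q else 0)
      = (\<Sum>(p, q)\<in>{(p, q). p \<in> P \<and> q \<in> P \<and> f p + f q = 0}. c p * c q)"
    using assms(1) by (intro sum.mono_neutral_cong_right) (auto split: if_splits)
  ultimately show ?thesis by (simp only:)
qed

section \<open>Counting the solutions of hk + h'k' = 0\<close>

definition energy_set :: "nat \<Rightarrow> ((nat \<times> int) \<times> (nat \<times> int)) set" where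
  "energy_set N = {((h, k), (h', k')). h \<in> {1..N} \<and> h' \<in> {1..N}
     \<and> k \<in> {-int N..int N} \<and> k' \<in> {-int N..int N} \<and> int h * k + int h' * k' = 0}"

lemma card_energy_set_le: "real (card (energy_set N)) \<le> 6 * (real N)\<^sup>2 * harm N"
proof -
  txt \<open>
    A solution with \<open>h' \<le> h\<close> has the form \<open>h = ga\<close>, \<open>h' = gb\<close>, \<open>k = -bm\<close>, \<open>k' = am\<close>, where
    \<open>b \<le> a\<close>; for each of the \<open>a\<close> values of \<open>b\<close> there are \<open>O(N/a)\<close> choices of \<open>g\<close> and of \<open>m\<close>.
  \<close>
  define R where "R = Sigma {1..N} (\<lambda>a. {1..a} \<times> {1..N div a} \<times> {-int (N div a)..int (N div a)})"
  define \<phi> where "\<phi> = (\<lambda>(a, b, g, m). ((g * a, - int b * m), (g * b, int a * m)))"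
  define E1 where "E1 = {((h, k), (h', k')) \<in> energy_set N. h' \<le> h}"
  have fin: "finite R" unfolding R_def by auto
  have sub: "E1 \<subseteq> \<phi> ` R"
  proof
    fix p assume "p \<in> E1"
    then obtain h k h' k' where p: "p = ((h, k), (h', k'))" and le: "h' \<le> h"
      and h: "1 \<le> h" "h \<le> N" "1 \<le> h'" "h' \<le> N" and k: "\<bar>k\<bar> \<le> int N" "\<bar>k'\<bar> \<le> int N"
      and eq: "int h * k + int h' * k' = 0"
      by (auto simp: E1_def energy_set_def)
    define g where "g = gcd h h'"
    define a where "a = h div g"
    define b where "b = h' div g"
    have g: "g \<ge> 1" using h by (simp add: g_def Suc_le_eq)
    have ha: "h = g * a" and hb: "h' = g * b" by (auto simp: a_def b_def g_def)
    have cop: "coprime a b" using h unfolding a_def b_def g_def by (intro div_gcd_coprime) auto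
    have a1: "1 \<le> a" "1 \<le> b" using h ha hb by (auto simp: Suc_le_eq intro: Nat.gr0I)
    have ba: "b \<le> a" using le g ha hb by simp
    have "int g * (int a * k + int b * k') = 0" using eq ha hb by (simp add: algebra_simps)
    then have eq': "int a * k + int b * k' = 0" using g by simp
    then have "int a dvd int b * k'" by (metis dvd_add_right_iff dvd_triv_left dvd_0_right)
    then have "int a dvd k'" using cop by (metis coprime_dvd_mult_right_iff coprime_int_iff)
    then obtain m where m: "k' = int a * m" by blast
    then have "int a * (k + int b * m) = 0" using eq' by (simp add: algebra_simps)
    then have km: "k = - int b * m" using a1 by simp
    have "int a * \<bar>m\<bar> \<le> int N" using k m by (simp add: abs_mult)
    then have "a * nat \<bar>m\<bar> \<le> N"
      by (metis nat_int nat_mult_distrib nat_le_iff of_nat_0_le_iff abs_ge_zero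
          nat_int_comparison(3) of_nat_mult int_nat_eq)
    then have "nat \<bar>m\<bar> \<le> N div a" using a1 by (simp add: less_eq_div_iff_mult_less_eq mult.commute)
    then have mb: "\<bar>m\<bar> \<le> int (N div a)" by linarith
    have gb: "g \<le> N div a" using a1 h ha by (simp add: less_eq_div_iff_mult_less_eq)
    have aN: "a \<le> N" using h ha g by (metis le_trans mult_le_mono1 nat_mult_1)
    have "(a, b, g, m) \<in> R" using a1 ba g gb mb aN by (auto simp: R_def)
    moreover have "p = \<phi> (a, b, g, m)" by (simp add: \<phi>_def p ha hb m km)
    ultimately show "p \<in> \<phi> ` R" by blast
  qed
  \<comment> \<open>Exchanging the two pairs reduces h < h' to the parametrized case, at the cost of
    a factor 2.\<close>
  have "energy_set N \<subseteq> E1 \<union> prod.swap ` E1"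
  proof
    fix p assume p: "p \<in> energy_set N"
    then have "prod.swap p \<in> energy_set N" by (auto simp: energy_set_def)
    moreover obtain h k h' k' where "p = ((h, k), (h', k'))" by (metis prod.exhaust)
    ultimately show "p \<in> E1 \<union> prod.swap ` E1"
      using p by (cases "h' \<le> h") (auto simp: E1_def image_iff)
  qed
  moreover have E1fin: "finite E1" using fin sub finite_surj by blast
  ultimately have "card (energy_set N) \<le> card (E1 \<union> prod.swap ` E1)"
    by (intro card_mono) auto
  also have "\<dots> \<le> card E1 + card (prod.swap ` E1)" by (rule card_Un_le)
  also have "\<dots> \<le> card E1 + card E1" using card_image_le[OF E1fin] by simp
  also have "card E1 \<le> card R" using surj_card_le[OF fin sub] .
  finally have "real (card (energy_set N)) \<le> 2 * real (card R)" by simp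
  also have "real (card R) = (\<Sum>a=1..N. real (a * ((N div a) * (2 * (N div a) + 1))))"
    unfolding R_def by (subst card_SigmaI)
      (auto simp: card_cartesian_product nat_add_distrib intro!: sum.cong)
  \<comment> \<open>As a \<le> N, the 1 in the count of m is at most N/a, so m takes at most 3N/a
    values; with a choices of b and at most N/a of g this gives 3 N^2 / a.\<close>
  also have "\<dots> \<le> (\<Sum>a=1..N. 3 * (real N)\<^sup>2 * inverse (real a))"
  proof (intro sum_mono)
    fix a assume a: "a \<in> {1..N}"
    have q: "real (N div a) \<le> real N / real a" by (simp add: of_nat_div_le_of_nat)
    have "1 \<le> real N / real a" using a by simp
    then have "real (a * ((N div a) * (2 * (N div a) + 1)))
        \<le> real a * ((real N / real a) * (3 * (real N / real a)))"
      unfolding of_nat_mult using q by (intro mult_mono) auto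
    also have "\<dots> = 3 * (real N)\<^sup>2 * inverse (real a)"
      using a by (simp add: field_simps power2_eq_square)
    finally show "real (a * ((N div a) * (2 * (N div a) + 1))) \<le> 3 * (real N)\<^sup>2 * inverse (real a)" .
  qed
  also have "\<dots> = 3 * (real N)\<^sup>2 * harm N" by (simp add: harm_def sum_distrib_left)
  finally show ?thesis by simp
qed

text \<open>By orthogonality the integral is a sum over \<open>energy_set N\<close> of products of
  two coefficients, each at most \<open>harm N\<close>; the cardinality supplies the third factor
  \<open>harm N\<close>.\<close>

lemma sum_fejer_average_second_moment:
  obtains J where "((\<lambda>y. (\<Sum>h=1..N. fejer_average N (2 * real h * y))\<^sup>2) has_integral J) {0..1}"
    and "J \<le> 6 * (real N)\<^sup>2 * (harm N) ^ 3"
proof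
  let ?P = "{1..N} \<times> {-int N..int N}"
  let ?f = "\<lambda>(h, k). 2 * int h * k"
  let ?c = "\<lambda>(h :: nat, k). fejer_coeff N k"
  have "of_real (\<Sum>h=1..N. fejer_average N (2 * real h * y))
      = (\<Sum>p\<in>?P. of_real (?c p) * cis (2 * pi * (of_int (?f p) * y)))" for y
    unfolding of_real_sum fejer_average_expansion sum.cartesian_product
    by (intro sum.cong) (auto simp: mult_ac)
  from has_integral_trig_poly_squared[OF _ this]
  show "((\<lambda>y. (\<Sum>h=1..N. fejer_average N (2 * real h * y))\<^sup>2) has_integral
     (\<Sum>(p, q)\<in>{(p, q). p \<in> ?P \<and> q \<in> ?P \<and> ?f p + ?f q = 0}. ?c p * ?c q)) {0..1}"
    by simp
  \<comment> \<open>The common factor 2 of the frequencies cancels from the condition that they sum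
    to 0.\<close>
  have E: "{(p, q). p \<in> ?P \<and> q \<in> ?P \<and> ?f p + ?f q = 0} = energy_set N"
    unfolding energy_set_def by auto
  have "(\<Sum>(p, q)\<in>energy_set N. ?c p * ?c q) \<le> (\<Sum>_\<in>energy_set N. harm N * harm N)"
    by (intro sum_mono)
      (auto intro!: mult_mono fejer_coeff_le_harm fejer_coeff_nonneg harm_nonneg)
  also have "\<dots> = real (card (energy_set N)) * (harm N * harm N)" by simp
  also have "\<dots> \<le> (6 * (real N)\<^sup>2 * harm N) * (harm N * harm N)"
    by (intro mult_right_mono card_energy_set_le) (simp add: harm_nonneg)
  finally show "(\<Sum>(p, q)\<in>{(p, q). p \<in> ?P \<and> q \<in> ?P \<and> ?f p + ?f q = 0}. ?c p * ?c q)
      \<le> 6 * (real N)\<^sup>2 * (harm N) ^ 3"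
    unfolding E by (simp add: power3_eq_cube mult_ac)
qed

section \<open>Moments of the maximal Gauss sum\<close>

text \<open>The difference of \<open>harm n\<close> and ln n decreases in n and equals 1 at n =
  1.\<close>

lemma harm_le_ln_plus_1:
  assumes "1 \<le> N"
  shows "harm N \<le> ln (real N) + 1"
proof -
  obtain n where n: "N = Suc n" using assms by (cases N) auto
  have "harm (Suc n) - ln (real (Suc n)) \<le> harm (Suc 0) - ln (real (Suc 0))"
    using decseq_harm_diff_ln by (rule decseqD) simp
  then show ?thesis by (simp add: n harm_def)
qed

text \<open>Only the majorant g has to be integrable: a non-integrable f has integral 0 by
  convention, and then g \<ge> 0 gives the bound. Hence it applies to a supremum without a
  measurability argument.\<close>

lemma set_lebesgue_integral_le_has_integral:
  fixes f g :: "real \<Rightarrow> real"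
  assumes cont: "continuous_on {a..b} g" and int: "(g has_integral I) {a..b}"
    and le: "\<And>y. y \<in> {a..b} \<Longrightarrow> f y \<le> g y" and nonneg: "\<And>y. y \<in> {a..b} \<Longrightarrow> 0 \<le> g y"
  shows "(LINT y:{a..b}|lborel. f y) \<le> I"
proof -
  have g: "set_integrable lborel {a..b} g"
    by (rule borel_integrable_atLeastAtMost'[OF cont])
  have "(LINT y:{a..b}|lborel. f y) \<le> (LINT y:{a..b}|lborel. g y)"
    unfolding set_lebesgue_integral_def
    by (rule integral_mono'[OF g[unfolded set_integrable_def]])
      (auto simp: indicator_def le nonneg)
  also have "\<dots> = integral {a..b} g" by (rule set_borel_integral_eq_integral(2)[OF g])
  finally show ?thesis using integral_unique[OF int] by simp
qed

lemma norm_gauss_sum_le: "norm (gauss_sum x y N) \<le> real N"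
proof -
  have "norm (expi2 (of_real t)) = 1" for t
    by (simp add: expi2_def norm_exp_eq_Re)
  then show ?thesis
    unfolding gauss_sum_def
    by (intro order_trans[OF sum_norm_le[where g = "\<lambda>_. 1"]])
      (simp_all del: of_real_add of_real_mult of_real_power)
qed

lemma L_rho_le_powr:
  assumes "\<rho> > 0" and cont: "continuous_on {0..1} g" and int: "(g has_integral I) {0..1}"
    and le: "\<And>x y. norm (gauss_sum x y N) powr \<rho> \<le> g y" and "I \<le> K"
  shows "L_rho \<rho> N \<le> K powr (1 / \<rho>)"
proof -
  let ?S = "\<lambda>y. SUP x\<in>unit_T. norm (gauss_sum x y N) powr \<rho>"
  have ne: "unit_T \<noteq> {}" by (simp add: unit_T_def)
  have g: "0 \<le> g y" for y using le[of 0 y] by (smt (verit) powr_ge_zero)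
  have upper: "?S y \<le> g y" for y by (rule cSUP_least[OF ne le])
  have "bdd_above ((\<lambda>x. norm (gauss_sum x y N) powr \<rho>) ` unit_T)" for y
    using le by (intro bdd_aboveI2) auto
  then have "norm (gauss_sum 0 y N) powr \<rho> \<le> ?S y" for y
    by (rule cSUP_upper[rotated]) (simp add: unit_T_def)
  then have nonneg: "0 \<le> ?S y" for y by (rule order_trans[OF powr_ge_zero])
  have "(LINT y:unit_T|lborel. ?S y) \<le> I"
    unfolding unit_T_def
    by (rule set_lebesgue_integral_le_has_integral[OF cont int upper[unfolded unit_T_def] g])
  \<comment> \<open>The outer power 1/\<rho> is monotone only on nonnegative bases.\<close>
  moreover have "0 \<le> (LINT y:unit_T|lborel. ?S y)"
    unfolding set_lebesgue_integral_def by (intro Bochner_Integration.integral_nonneg) (simp add: nonneg)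
  ultimately show ?thesis
    unfolding L_rho_def using assms(1,5) by (intro powr_mono2) auto
qed

text \<open>An elementary substitute for Hoelder's inequality: with s = \<rho>/4 it bounds moments
  below the fourth by the fourth.\<close>

lemma powr_le_one_plus:
  fixes v :: real
  assumes "0 \<le> v" "0 \<le> s" "s \<le> 1"
  shows "v powr s \<le> 1 + v"
proof (cases "v \<le> 1")
  case True
  then have "v powr s \<le> 1" using assms powr_mono2[of s v 1] by simp
  then show ?thesis using assms by simp
next
  case False
  then have "v powr s \<le> v powr 1" using assms by (intro powr_mono) auto
  then show ?thesis using False by simp
qed

theorem theorem1p3:
  fixes \<rho> :: real
  assumes "\<rho> > 0"
  shows "\<forall>\<epsilon>>0. \<forall>\<^sub>F N in sequentially.
           L_rho \<rho> N \<le> real N powr (1 / 2 + \<epsilon>) + real N powr (1 - 2 / \<rho> + \<epsilon>)"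
proof (intro allI impI)
  fix \<epsilon> :: real assume \<epsilon>: "\<epsilon> > 0"
  have "\<forall>\<^sub>F N in sequentially. 6534 * (ln (real N) + 1) ^ 3 \<le> real N powr \<epsilon>"
    using \<epsilon> by real_asymp
  \<comment> \<open>For \<rho> < 4 the main factor is \<open>B powr (1 / 4)\<close>, that is N to
    the power 1/2 + \<epsilon>/4; the remaining 3\<epsilon>/4 absorbs the constant.\<close>
  moreover have "\<forall>\<^sub>F N in sequentially. 2 powr (1 / \<rho>) \<le> real N powr (3 * \<epsilon> / 4)"
    using \<epsilon> by real_asymp
  ultimately show "\<forall>\<^sub>F N in sequentially.
      L_rho \<rho> N \<le> real N powr (1 / 2 + \<epsilon>) + real N powr (1 - 2 / \<rho> + \<epsilon>)"
    using eventually_ge_at_top[of 1]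
  proof eventually_elim
    case (elim N)
    define u where "u y = (33 * (\<Sum>h=1..N. fejer_average N (2 * real h * y)))\<^sup>2" for y
    txt \<open>\<open>6534 = 33\<^sup>2 * 6\<close>, so \<open>B\<close> bounds the integral of \<open>u\<close>.\<close>
    define B where "B = real N powr (2 + \<epsilon>)"
    have N: "0 < real N" "1 \<le> real N" using elim by auto
    have B: "B > 0" using N by (simp add: B_def)
    obtain J where J: "((\<lambda>y. (\<Sum>h=1..N. fejer_average N (2 * real h * y))\<^sup>2) has_integral J) {0..1}"
      and Jle: "J \<le> 6 * (real N)\<^sup>2 * (harm N) ^ 3"
      using sum_fejer_average_second_moment by blast
    have u_int: "(u has_integral 1089 * J) {0..1}"
      unfolding u_def power_mult_distrib using has_integral_mult_right[OF J, of 1089] by simp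
    have u_cont: "continuous_on {0..1} u"
      unfolding u_def fejer_average_def by (intro continuous_intros) auto
    have "1089 * J \<le> 6534 * (harm N) ^ 3 * (real N)\<^sup>2" using Jle by (simp add: mult_ac)
    also have "\<dots> \<le> 6534 * (ln (real N) + 1) ^ 3 * (real N)\<^sup>2"
      using elim by (intro mult_right_mono mult_left_mono power_mono harm_le_ln_plus_1 harm_nonneg) auto
    also have "\<dots> \<le> real N powr \<epsilon> * (real N)\<^sup>2"
      using elim by (intro mult_right_mono) auto
    also have "\<dots> = B" using N by (simp add: B_def powr_add)
    finally have JB: "1089 * J \<le> B" .
    have G4: "norm (gauss_sum x y N) ^ 4 \<le> u y" for x y
    proof -
      have "norm (gauss_sum x y N) ^ 4 = ((norm (gauss_sum x y N))\<^sup>2)\<^sup>2" by simp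
      also have "\<dots> \<le> u y"
        unfolding u_def using elim by (intro power_mono gauss_sum_squared_le) auto
      finally show ?thesis .
    qed
    have powr4: "norm (gauss_sum x y N) powr 4 = norm (gauss_sum x y N) ^ 4" for x y
      by (cases "norm (gauss_sum x y N) = 0") (auto simp: powr_numeral)
    show ?case
    proof (cases "\<rho> \<ge> 4")
      case True
      have "norm (gauss_sum x y N) powr \<rho> \<le> real N powr (\<rho> - 4) * u y" for x y
      proof -
        have "norm (gauss_sum x y N) powr \<rho>
            = norm (gauss_sum x y N) powr (\<rho> - 4) * norm (gauss_sum x y N) powr 4"
          unfolding powr_add[symmetric] by (simp only: diff_add_cancel)
        also have "\<dots> \<le> real N powr (\<rho> - 4) * u y"
          unfolding powr4 using True
          by (intro mult_mono powr_mono2 norm_gauss_sum_le G4) auto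
        finally show ?thesis .
      qed
      moreover have "real N powr (\<rho> - 4) * (1089 * J) \<le> real N powr (\<rho> - 4) * B"
        by (intro mult_left_mono JB) auto
      ultimately have "L_rho \<rho> N \<le> (real N powr (\<rho> - 4) * B) powr (1 / \<rho>)"
        using assms
        by (intro L_rho_le_powr[where g = "\<lambda>y. real N powr (\<rho> - 4) * u y"
              and I = "real N powr (\<rho> - 4) * (1089 * J)"]
            continuous_on_mult_left u_cont has_integral_mult_right u_int)
      \<comment> \<open>The exponents add up to (\<rho> - 4) + (2 + \<epsilon>). After division by
        \<rho> the loss is \<epsilon>/\<rho> \<le> \<epsilon>.\<close>
      also have "\<dots> = real N powr ((\<rho> + \<epsilon> - 2) / \<rho>)"
        by (simp add: B_def powr_powr flip: powr_add)
      also have "\<dots> \<le> real N powr (1 - 2 / \<rho> + \<epsilon>)"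
      proof (intro powr_mono N(2))
        have "\<epsilon> * 1 \<le> \<epsilon> * \<rho>" using True \<epsilon> by (intro mult_left_mono) auto
        then have "\<epsilon> / \<rho> \<le> \<epsilon>" using assms by (simp add: divide_le_eq)
        then show "(\<rho> + \<epsilon> - 2) / \<rho> \<le> 1 - 2 / \<rho> + \<epsilon>"
          using assms by (simp add: add_divide_distrib diff_divide_distrib)
      qed
      finally show ?thesis by (smt (verit) powr_ge_zero)
    next
      case False
      \<comment> \<open>Dividing by \<open>B\<close> first makes the integral of
        \<open>u y / B\<close> at most 1, so that of \<open>g\<close> is at most
        \<open>2 * B powr (\<rho> / 4)\<close>, the right order of magnitude in
        \<open>B\<close>.\<close>
      define g where "g y = B powr (\<rho> / 4) * (1 + u y / B)" for y
      have "norm (gauss_sum x y N) powr \<rho> \<le> g y" for x y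
      proof -
        have "norm (gauss_sum x y N) powr \<rho> = (norm (gauss_sum x y N) ^ 4) powr (\<rho> / 4)"
          unfolding powr4[symmetric] powr_powr by simp
        also have "\<dots> \<le> (u y) powr (\<rho> / 4)"
          using assms by (intro powr_mono2 G4) auto
        also have "\<dots> = (B * (u y / B)) powr (\<rho> / 4)" using B by simp
        also have "\<dots> = B powr (\<rho> / 4) * (u y / B) powr (\<rho> / 4)"
          by (rule powr_mult)
        also have "\<dots> \<le> g y"
          unfolding g_def using B assms False by (intro mult_left_mono powr_le_one_plus) (auto simp: u_def)
        finally show ?thesis .
      qed
      moreover have "(g has_integral B powr (\<rho> / 4) * (1 + 1089 * J / B)) {0..1}"
      proof -
        have "((\<lambda>y :: real. 1 :: real) has_integral 1) {0..1}"
          using has_integral_const_real[of "1 :: real" 0 1] by simp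
        then show ?thesis unfolding g_def
          by (intro has_integral_mult_right has_integral_add has_integral_divide u_int)
      qed
      moreover have "continuous_on {0..1} g"
        unfolding g_def using B by (intro continuous_intros u_cont) auto
      moreover have "B powr (\<rho> / 4) * (1 + 1089 * J / B) \<le> B powr (\<rho> / 4) * 2"
        using JB B by (intro mult_left_mono) auto
      ultimately have "L_rho \<rho> N \<le> (B powr (\<rho> / 4) * 2) powr (1 / \<rho>)"
        using assms by (intro L_rho_le_powr) auto
      also have "\<dots> = B powr (1 / 4) * 2 powr (1 / \<rho>)"
        using assms by (simp add: powr_mult powr_powr)
      also have "\<dots> \<le> B powr (1 / 4) * real N powr (3 * \<epsilon> / 4)"
        using elim by (intro mult_left_mono) auto
      also have "\<dots> = real N powr (1 / 2 + \<epsilon>)"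
        unfolding B_def powr_powr powr_add[symmetric] by (rule arg_cong2[of _ _ _ _ "(powr)"])
          (simp_all add: field_simps)
      finally show ?thesis by (smt (verit) powr_ge_zero)
    qed
  qed
qed

end
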